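(* For each integer $d\geq 6$, there are infinitely many pairwise combinatorially inequivalent $d$-dimensional convex polytopes that are Forman--Ricci-positive.
   Context: Polytopes are convex polytopes, considered up to combinatorial equivalence (isomorphism of face lattices). For an edge $e$ of a polytope $P$, let $\mathcal{F}\uparrow(e)$ be the set of $2$-faces of $P$ containing $e$. Two distinct edges $e,e'$ are parallel neighbors if either (i) they share a vertex but are not contained in a common $2$-face, or (ii) they are vertex-disjoint but are contained in a common $2$-face. Let $\mathcal{E}(e)$ be the set of parallel neighbors of $e$. The Forman--Ricci curvature of $e$ is $\mathcal{F}(e)=|\mathcal{F}\uparrow(e)|+2-|\mathcal{E}(e)|$. A polytope is Forman--Ricci-positive if $\mathcal{F}(e)>0$ for every edge $e$. *)

theory Defs
  imports "HOL-Analysis.Analysis"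
begin

text \<open>\<^term>\<open>(face_of)\<close> admits the empty set and the polytope itself as faces, so for a polytope
  \<^term>\<open>P\<close> the set \<^term>\<open>{F. F face_of P}\<close> ordered by inclusion is the full face lattice.\<close>

definition comb_equiv :: "'a::euclidean_space set \<Rightarrow> 'b::euclidean_space set \<Rightarrow> bool" where
  "comb_equiv P Q \<longleftrightarrow>
     (\<exists>\<phi>. bij_betw \<phi> {F. F face_of P} {G. G face_of Q} \<and>
          (\<forall>F G. F face_of P \<longrightarrow> G face_of P \<longrightarrow> (F \<subseteq> G \<longleftrightarrow> \<phi> F \<subseteq> \<phi> G)))"

definition two_faces_above :: "'a::euclidean_space set \<Rightarrow> 'a set \<Rightarrow> 'a set set" where
  "two_faces_above P e = {F. F face_of P \<and> aff_dim F = 2 \<and> e \<subseteq> F}"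

definition share_vertex :: "'a::euclidean_space set \<Rightarrow> 'a set \<Rightarrow> 'a set \<Rightarrow> bool" where
  "share_vertex P e e' \<longleftrightarrow> (\<exists>v. v extreme_point_of P \<and> v \<in> e \<and> v \<in> e')"

definition share_two_face :: "'a::euclidean_space set \<Rightarrow> 'a set \<Rightarrow> 'a set \<Rightarrow> bool" where
  "share_two_face P e e' \<longleftrightarrow> (\<exists>F. F face_of P \<and> aff_dim F = 2 \<and> e \<subseteq> F \<and> e' \<subseteq> F)"

definition parallel_neighbors :: "'a::euclidean_space set \<Rightarrow> 'a set \<Rightarrow> 'a set set" where
  "parallel_neighbors P e =
     {e'. e' edge_of P \<and> e' \<noteq> e \<and>
          (share_vertex P e e' \<and> \<not> share_two_face P e e' \<or>
           \<not> share_vertex P e e' \<and> share_two_face P e e')}"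

definition forman_ricci :: "'a::euclidean_space set \<Rightarrow> 'a set \<Rightarrow> int" where
  "forman_ricci P e =
     int (card (two_faces_above P e)) + 2 - int (card (parallel_neighbors P e))"

definition forman_ricci_positive :: "'a::euclidean_space set \<Rightarrow> bool" where
  "forman_ricci_positive P \<longleftrightarrow> (\<forall>e. e edge_of P \<longrightarrow> forman_ricci P e > 0)"

end

theory Submission
  imports Defs
begin

text \<open>Cyclic polytopes of dimension at least \<open>6\<close> are 3-neighborly and simplicial: a set \<open>S\<close> of at
  most three points of the moment curve is cut out by the polynomial \<open>\<Prod>s\<in>S. (t - s)\<^sup>2\<close>, whose degree
  is at most \<open>6\<close>. Hence two edges with a common vertex always lie in a common triangle, and
  two edges of a 2-face, which is a triangle, always have a common vertex. So no edge has a parallel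
  neighbor, and its curvature is at least \<open>2\<close>. The number of faces grows with the number of
  vertices, which gives infinitely many combinatorial types.\<close>

text \<open>Only this property of the curve is ever used, so coordinates stay hidden: zeros and
  signs of a polynomial become positions of curve points relative to a hyperplane.\<close>

definition moment_curve :: "(real \<Rightarrow> 'a::euclidean_space) \<Rightarrow> bool" where
  "moment_curve \<gamma> \<longleftrightarrow>
     (\<forall>p. degree p \<le> DIM('a) \<longrightarrow> (\<exists>c k. \<forall>t. c \<bullet> \<gamma> t + k = poly p t))"

lemma exists_moment_curve: "\<exists>\<gamma> :: real \<Rightarrow> 'a::euclidean_space. moment_curve \<gamma>"
proof -
  obtain h where h: "bij_betw h (Basis :: 'a set) {1..DIM('a)}"
    using finite_same_card_bij[of "Basis :: 'a set" "{1..DIM('a)}"] by auto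
  \<comment> \<open>\<open>h\<close> numbers the basis vectors by exponents, giving the classical
    curve with coordinates t, t^2, ..., up to the dimension. Exponent 0 is missing, so the constant
    coefficient of \<open>p\<close> becomes the offset \<open>k\<close>.\<close>
  define \<gamma> :: "real \<Rightarrow> 'a" where "\<gamma> t = (\<Sum>b\<in>Basis. t ^ h b *\<^sub>R b)" for t
  have "\<exists>c k. \<forall>t. c \<bullet> \<gamma> t + k = poly p t" if p: "degree p \<le> DIM('a)" for p
  proof (intro exI allI)
    fix t
    have "(\<Sum>b\<in>Basis. coeff p (h b) *\<^sub>R b) \<bullet> \<gamma> t = (\<Sum>b\<in>Basis. coeff p (h b) * t ^ h b)"
      by (simp add: \<gamma>_def inner_sum_right mult.commute)
    also have "\<dots> = (\<Sum>i=1..DIM('a). coeff p i * t ^ i)"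
      using sum.reindex_bij_betw[OF h, of "\<lambda>i. coeff p i * t ^ i"] .
    also have "\<dots> + coeff p 0 = (\<Sum>i\<le>DIM('a). coeff p i * t ^ i)"
      by (simp add: atMost_atLeast0 sum.atLeast_Suc_atMost)
    also have "\<dots> = poly p t"
      unfolding poly_altdef using p
      by (intro sum.mono_neutral_right) (auto simp: coeff_eq_0)
    finally show "(\<Sum>b\<in>Basis. coeff p (h b) *\<^sub>R b) \<bullet> \<gamma> t + coeff p 0 = poly p t" .
  qed
  then show ?thesis unfolding moment_curve_def by blast
qed

lemma degree_prod_linear:
  fixes S :: "real set"
  shows "degree (\<Prod>s\<in>S. [:- s, 1:]) = card S"
  by (subst degree_prod_eq_sum_degree) auto

context
  fixes \<gamma> :: "real \<Rightarrow> 'a::euclidean_space"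
  assumes moment: "moment_curve \<gamma>"
begin

lemma moment_curve_poly:
  assumes "degree p \<le> DIM('a)"
  obtains c k where "\<And>t. c \<bullet> \<gamma> t + k = poly p t"
  using assms moment unfolding moment_curve_def by blast

lemma inj_moment_curve: "inj \<gamma>"
proof (rule injI)
  fix s t assume "\<gamma> s = \<gamma> t"
  moreover obtain c k where "\<And>t. c \<bullet> \<gamma> t + k = poly [:0, 1:] t"
    using moment_curve_poly[of "[:0, 1:]"] by (auto simp: Suc_leI)
  ultimately show "s = t" by (metis poly_pCons poly_0 add_0 mult_zero_right mult_1_right add.right_neutral)
qed

text \<open>If \<open>\<gamma> s\<close> depended on the other points, it would lie on every
  hyperplane through them. The polynomial with simple roots exactly at the other parameters has
  degree at most the dimension and gives such a hyperplane missing
  \<open>\<gamma> s\<close>.\<close>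

lemma affine_independent_moment_curve:
  assumes "finite S" "card S \<le> Suc DIM('a)"
  shows "\<not> affine_dependent (\<gamma> ` S)"
proof
  assume "affine_dependent (\<gamma> ` S)"
  then obtain s where s: "s \<in> S" "\<gamma> s \<in> affine hull (\<gamma> ` S - {\<gamma> s})"
    unfolding affine_dependent_def by auto
  define p where "p = (\<Prod>r\<in>S - {s}. [:- r, 1:])"
  have "degree p \<le> DIM('a)"
    using assms s by (simp add: p_def degree_prod_linear)
  then obtain c k where ck: "\<And>t. c \<bullet> \<gamma> t + k = poly p t"
    using moment_curve_poly by blast
  have "poly p r = 0" if "r \<in> S - {s}" for r
    using that assms by (auto simp: p_def poly_prod)
  with ck have "\<gamma> ` S - {\<gamma> s} \<subseteq> {x. c \<bullet> x = - k}"
    by (auto simp: eq_neg_iff_add_eq_0) blast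
  then have "affine hull (\<gamma> ` S - {\<gamma> s}) \<subseteq> {x. c \<bullet> x = - k}"
    by (rule hull_minimal) (rule affine_hyperplane)
  with s have "c \<bullet> \<gamma> s = - k" by blast
  then have "poly p s = 0" using ck[of s] by simp
  then show False using assms by (simp add: p_def poly_prod)
qed

lemma aff_dim_moment_curve:
  assumes "finite S" "card S \<le> Suc DIM('a)"
  shows "aff_dim (\<gamma> ` S) = int (card S) - 1"
proof -
  have "card (\<gamma> ` S) = card S"
    using inj_moment_curve by (meson card_image inj_on_subset subset_UNIV)
  then show ?thesis
    using aff_dim_affine_independent[OF affine_independent_moment_curve[OF assms]] by simp
qed

text \<open>The strict dimension bound excludes large \<open>W\<close>: any
  \<open>Suc DIM('a)\<close> points of the curve already span the whole space. The remaining sets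
  are affinely independent.\<close>

lemma card_eq_aff_dim_moment_curve:
  assumes "finite W" "W \<subseteq> range \<gamma>" "aff_dim W < int DIM('a)"
  shows "int (card W) = aff_dim W + 1"
proof -
  obtain S where S: "W = \<gamma> ` S" using assms(2) by (auto simp: subset_image_iff)
  then have fin: "finite S"
    using assms(1) inj_moment_curve by (metis finite_imageD inj_on_subset subset_UNIV)
  have cd: "card W = card S"
    unfolding S using inj_moment_curve by (meson card_image inj_on_subset subset_UNIV)
  show ?thesis
  proof (cases "card S \<le> Suc DIM('a)")
    case True
    then show ?thesis using aff_dim_moment_curve[OF fin] S cd by simp
  next
    case False
    then obtain R where R: "R \<subseteq> S" "card R = Suc DIM('a)" "finite R"
      by (metis nat_le_linear obtain_subset_with_card_n)
    then have "int DIM('a) = aff_dim (\<gamma> ` R)"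
      using aff_dim_moment_curve[of R] by simp
    also have "\<dots> \<le> aff_dim W"
      unfolding S by (intro aff_dim_subset image_mono R)
    finally show ?thesis using assms(3) by simp
  qed
qed

lemma face_of_convex_hull_moment_curve:
  assumes "finite T" "S \<subseteq> T" "2 * card S \<le> DIM('a)"
  shows "(convex hull (\<gamma> ` S)) face_of (convex hull (\<gamma> ` T))"
proof (rule face_of_convex_hulls)
  show "finite (\<gamma> ` T)" "\<gamma> ` S \<subseteq> \<gamma> ` T" using assms by auto
  define p where "p = (\<Prod>s\<in>S. [:- s, 1:]) ^ 2"
  have fin: "finite S" using assms finite_subset by blast
  have "degree p \<le> DIM('a)"
    using assms(3) degree_power_le[of "\<Prod>s\<in>S. [:- s, 1:]" 2]
    by (simp add: p_def degree_prod_linear)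
  then obtain c k where ck: "\<And>t. c \<bullet> \<gamma> t + k = poly p t"
    using moment_curve_poly by blast
  have zero: "poly p t = 0" if "t \<in> S" for t
    using that fin by (auto simp: p_def poly_prod poly_power)
  have pos: "poly p t > 0" if "t \<notin> S" for t
    using that fin by (auto simp: p_def poly_prod poly_power)
  have "\<gamma> ` S \<subseteq> {x. c \<bullet> x = - k}"
    using ck zero by (auto simp: eq_neg_iff_add_eq_0)
  then have 1: "affine hull (\<gamma> ` S) \<subseteq> {x. c \<bullet> x = - k}"
    by (rule hull_minimal) (rule affine_hyperplane)
  have "- k < c \<bullet> \<gamma> t" if "t \<notin> S" for t
    using ck[of t] pos[OF that] by linarith
  then have "\<gamma> ` T - \<gamma> ` S \<subseteq> {x. c \<bullet> x > - k}"
    by auto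
  then have 2: "convex hull (\<gamma> ` T - \<gamma> ` S) \<subseteq> {x. c \<bullet> x > - k}"
    by (rule hull_minimal) (rule convex_halfspace_gt)
  show "affine hull (\<gamma> ` S) \<inter> convex hull (\<gamma> ` T - \<gamma> ` S) = {}"
    using 1 2 by fastforce
qed

lemma extreme_point_of_moment_curve_hull_iff:
  assumes "finite T" "2 \<le> DIM('a)"
  shows "v extreme_point_of (convex hull (\<gamma> ` T)) \<longleftrightarrow> v \<in> \<gamma> ` T"
proof
  assume "v \<in> \<gamma> ` T"
  then obtain t where "t \<in> T" "v = \<gamma> t" by blast
  then show "v extreme_point_of (convex hull (\<gamma> ` T))"
    using face_of_convex_hull_moment_curve[of T "{t}"] assms by (simp add: face_of_singleton)
qed (rule extreme_point_of_convex_hull)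

text \<open>This is simpliciality: a face of less than full dimension is spanned by its curve
  points, and these are affinely independent.\<close>

lemma face_of_moment_curve_hull:
  assumes "finite T" "2 \<le> DIM('a)"
    and F: "F face_of (convex hull (\<gamma> ` T))" and dim: "aff_dim F < int DIM('a)"
  shows "F = convex hull (\<gamma> ` T \<inter> F)" "int (card (\<gamma> ` T \<inter> F)) = aff_dim F + 1"
proof -
  obtain W where W: "W \<subseteq> \<gamma> ` T" "F = convex hull W"
    using face_of_convex_hull_subset[OF _ F] assms(1) by (auto simp: finite_imp_compact)
  \<comment> \<open>Curve points in \<open>F\<close> are vertices of the polytope, hence of
    \<open>F\<close>, and every generating set of \<open>F\<close> must contain its
    vertices.\<close>
  have "\<gamma> ` T \<inter> F \<subseteq> W"
  proof
    fix v assume v: "v \<in> \<gamma> ` T \<inter> F"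
    then have "v extreme_point_of F"
      using extreme_point_of_moment_curve_hull_iff[OF assms(1,2)] extreme_point_of_face[OF F] by blast
    then show "v \<in> W" using extreme_point_of_convex_hull W(2) by blast
  qed
  moreover have "W \<subseteq> \<gamma> ` T \<inter> F" using W hull_subset[of W] by auto
  ultimately have eq: "\<gamma> ` T \<inter> F = W" by blast
  show "F = convex hull (\<gamma> ` T \<inter> F)" using eq W(2) by simp
  have "aff_dim F = aff_dim W" using W(2) by (simp add: aff_dim_convex_hull)
  moreover have "finite W" using W(1) assms(1) finite_subset by blast
  ultimately show "int (card (\<gamma> ` T \<inter> F)) = aff_dim F + 1"
    unfolding eq using card_eq_aff_dim_moment_curve[of W] W(1) dim by auto
qed

lemma parallel_neighbors_moment_curve_hull:
  assumes fin: "finite T" and d: "6 \<le> DIM('a)" and e: "e edge_of (convex hull (\<gamma> ` T))"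
  shows "parallel_neighbors (convex hull (\<gamma> ` T)) e = {}"
proof -
  let ?V = "\<gamma> ` T"
  let ?P = "convex hull ?V"
  have d2: "2 \<le> DIM('a)" using d by simp
  note face = face_of_moment_curve_hull[OF fin d2]
  have edge: "f = convex hull (?V \<inter> f)" "card (?V \<inter> f) = 2" if "f edge_of ?P" for f
    using face[of f] that d unfolding edge_of_def by auto
  have "share_vertex ?P e f \<longleftrightarrow> share_two_face ?P e f" if f: "f edge_of ?P" "f \<noteq> e" for f
  proof -
    define A B where AB: "A = ?V \<inter> e" "B = ?V \<inter> f"
    have hull: "e = convex hull A" "f = convex hull B" and card: "card A = 2" "card B = 2"
      using edge[OF e] edge[OF f(1)] unfolding AB by blast+
    have finAB: "finite A" "finite B" using fin by (simp_all add: AB)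
    have "A \<noteq> B" using hull f(2) by auto
    have vertex: "share_vertex ?P e f \<longleftrightarrow> A \<inter> B \<noteq> {}"
      unfolding share_vertex_def extreme_point_of_moment_curve_hull_iff[OF fin d2] AB by blast
    \<comment> \<open>Both directions are now counting: the edges meet exactly when their union has
      fewer than four vertices.\<close>
    have card_Un: "card (A \<union> B) + card (A \<inter> B) = 4"
      using card_Un_Int[OF finAB] card by simp
    show ?thesis
    proof
      assume "share_vertex ?P e f"
      then have "card (A \<inter> B) > 0" using vertex finAB by (simp add: card_gt_0_iff)
      moreover have "card (A \<inter> B) < 2"
      proof (rule ccontr)
        assume "\<not> card (A \<inter> B) < 2"
        then have "A \<inter> B = A" "A \<inter> B = B"
          using card finAB by (simp_all add: card_seteq)
        with \<open>A \<noteq> B\<close> show False by simp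
      qed
      ultimately have c3: "card (A \<union> B) = 3" using card_Un by linarith
      have "A \<union> B \<subseteq> ?V" by (auto simp: AB)
      then obtain S where S: "S \<subseteq> T" "A \<union> B = \<gamma> ` S" by (auto simp: subset_image_iff)
      have cS: "card S = 3"
        using c3 S(2) inj_moment_curve by (metis card_image inj_on_subset subset_UNIV)
      have "(convex hull (A \<union> B)) face_of ?P"
        unfolding S(2) using face_of_convex_hull_moment_curve[OF fin S(1)] cS d by simp
      moreover have "aff_dim (convex hull (A \<union> B)) = 2"
        unfolding S(2) aff_dim_convex_hull
        using aff_dim_moment_curve[of S] cS d fin S(1) finite_subset by fastforce
      moreover have "e \<subseteq> convex hull (A \<union> B)" "f \<subseteq> convex hull (A \<union> B)"
        unfolding hull by (auto intro!: hull_mono)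
      ultimately show "share_two_face ?P e f" unfolding share_two_face_def by blast
    next
      assume "share_two_face ?P e f"
      then obtain F where F: "F face_of ?P" "aff_dim F = 2" "e \<subseteq> F" "f \<subseteq> F"
        unfolding share_two_face_def by blast
      have "card (?V \<inter> F) = 3" using face(2)[OF F(1)] F(2) d by simp
      moreover have "A \<union> B \<subseteq> ?V \<inter> F" using F(3,4) by (auto simp: AB)
      ultimately have "card (A \<union> B) \<le> 3" using fin by (metis card_mono finite_Int finite_imageI)
      then have "card (A \<inter> B) \<noteq> 0" using card_Un by linarith
      then show "share_vertex ?P e f" using vertex by auto
    qed
  qed
  then show ?thesis unfolding parallel_neighbors_def by blast
qed

text \<open>Counting the vertices alone suffices, since only unboundedness of the face count is
  needed later.\<close>

lemma card_faces_moment_curve_hull: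
  assumes "finite T" "2 \<le> DIM('a)"
  shows "card T \<le> card {F. F face_of (convex hull (\<gamma> ` T))}"
proof (rule card_inj_on_le)
  show "inj_on (\<lambda>t. {\<gamma> t}) T" using inj_moment_curve by (auto simp: inj_on_def)
  show "(\<lambda>t. {\<gamma> t}) ` T \<subseteq> {F. F face_of (convex hull (\<gamma> ` T))}"
    using extreme_point_of_moment_curve_hull_iff[OF assms] by (auto simp: face_of_singleton)
  show "finite {F. F face_of (convex hull (\<gamma> ` T))}"
    using assms(1) by (intro finite_polytope_faces polytope_convex_hull) simp
qed

end

lemma comb_equiv_card_faces:
  assumes "comb_equiv P Q"
  shows "card {F. F face_of P} = card {F. F face_of Q}"
  using assms unfolding comb_equiv_def by (blast intro: bij_betw_same_card)

theorem theorem1p7: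
  fixes d :: nat
  assumes "d \<ge> 6" and "DIM('a::euclidean_space) = d"
  shows "\<exists>\<P> :: 'a set set.
           infinite \<P> \<and>
           (\<forall>P\<in>\<P>. polytope P \<and> aff_dim P = int d \<and> forman_ricci_positive P) \<and>
           pairwise (\<lambda>P Q. \<not> comb_equiv P Q) \<P>"
proof -
  obtain \<gamma> :: "real \<Rightarrow> 'a" where \<gamma>: "moment_curve \<gamma>" using exists_moment_curve by blast
  \<comment> \<open>The first \<open>d + 1\<close> parameters already make the hull
    full-dimensional; \<open>n\<close> counts the additional vertices.\<close>
  define T where "T n = real ` {..<d + 1 + n}" for n
  define P where "P n = convex hull (\<gamma> ` T n)" for n
  define N :: "'a set \<Rightarrow> nat" where "N Q = card {F. F face_of Q}" for Q
  have fin: "finite (T n)" and cT: "card (T n) = d + 1 + n" for n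
    by (simp_all add: T_def card_image inj_on_def)
  have poly: "polytope (P n)" for n
    using fin by (auto simp: P_def intro: polytope_convex_hull)
  have dim: "aff_dim (P n) = int d" for n
  proof (rule antisym)
    show "aff_dim (P n) \<le> int d" using aff_dim_le_DIM assms(2) by metis
    have "int d = aff_dim (\<gamma> ` T 0)"
      using aff_dim_moment_curve[OF \<gamma> fin, of 0] cT assms(2) by simp
    also have "\<dots> \<le> aff_dim (\<gamma> ` T n)"
      by (intro aff_dim_subset image_mono) (auto simp: T_def)
    finally show "int d \<le> aff_dim (P n)" by (simp add: P_def aff_dim_convex_hull)
  qed
  have pos: "forman_ricci_positive (P n)" for n
    unfolding forman_ricci_positive_def forman_ricci_def P_def
    using parallel_neighbors_moment_curve_hull[OF \<gamma> fin] assms by auto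
  have "n \<le> N (P n)" for n
    using card_faces_moment_curve_hull[OF \<gamma> fin, of n] cT[of n] assms by (simp add: N_def P_def)
  then have inf: "infinite (N ` range P)"
    unfolding infinite_nat_iff_unbounded_le by blast
  \<comment> \<open>Choosing one polytope for each attained face count makes the family pairwise
    inequivalent, without having to show that the face count strictly increases with
    \<open>n\<close>.\<close>
  obtain \<P> where \<P>: "\<P> \<subseteq> range P" "inj_on N \<P>" "N ` range P = N ` \<P>"
    using subset_image_inj[of "N ` range P" N "range P"] by auto
  have "infinite \<P>" using inf \<P>(3) by auto
  moreover have "\<forall>Q\<in>\<P>. polytope Q \<and> aff_dim Q = int d \<and> forman_ricci_positive Q"
    using \<P>(1) poly dim pos by auto
  moreover have "pairwise (\<lambda>P Q. \<not> comb_equiv P Q) \<P>"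
    using \<P>(2) comb_equiv_card_faces unfolding pairwise_def inj_on_def N_def by blast
  ultimately show ?thesis by blast
qed

end
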